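(* For $\delta>0$ let $D_\delta(\Psi+J)=\{v\in D(\Psi+J):|\overline{v}|\le\delta\}$. Assume that there is some $\delta>0$ such that $$\inf_{D_\delta(\Psi+J)}\mathcal{E}=\inf_{D(\Psi+J)}\mathcal{E},$$ where $\mathcal{E}=\Psi+J+\mathbf{F}$. Then $\mathcal{E}$ is bounded from below on $X_{T+2}$ and attains its infimum at some $u\in D_\delta(\Psi+J)$, which is a solution of the problem $$\begin{cases}-\Delta[\phi(\Delta u(n-1))]=\nabla_u F(n,u(n)) & (n\in\mathbb{Z}[1,T]),\\ (\phi(\Delta u(0)),-\phi(\Delta u(T)))\in\partial j(u(0),u(T+1)).\end{cases}$$
   Context: $N\ge 1$ and $T\ge 2$ are fixed integers and $a>0$ is fixed. $\langle\cdot|\cdot\rangle$ and $|\cdot|$ are the Euclidean inner product and norm on $\mathbb{R}^N$, and $\mathbb{R}^N\times\mathbb{R}^N$ carries its usual inner product. $B_a=\{x\in\mathbb{R}^N:|x|<a\}$. $\mathbb{Z}[p,q]=\{p,\dots,q\}$. $X_{T+2}=\{u:\mathbb{Z}[0,T+1]\to\mathbb{R}^N\}$. For $v\in X_{T+2}$, $\overline{v}=\frac{1}{T+2}\sum_{k=0}^{T+1}v(k)$. $\Delta u(n-1)=u(n)-u(n-1)$, $\Delta[\phi(\Delta u(n-1))]=\phi(\Delta u(n))-\phi(\Delta u(n-1))$, $\|\Delta u\|_\infty=\max_{n\in\mathbb{Z}[1,T+1]}|\Delta u(n-1)|$. Assumptions. (1) $\phi: B_a\to\mathbb{R}^N$ is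 a homeomorphism from $B_a$ onto $\mathbb{R}^N$ with $\phi(0)=0$ and $\phi=\nabla\Phi$ on $B_a$, where $\Phi:\overline{B}_a\to\mathbb{R}$ is of class $C^1$ on $B_a$, continuous and strictly convex on $\overline{B}_a$, $\Phi(0)=0$. (2) $F=F(n,u):\mathbb{Z}[1,T]\times\mathbb{R}^N\to\mathbb{R}$ is continuous, $\nabla_uF$ exists and is continuous on $\mathbb{Z}[1,T]\times\mathbb{R}^N$, and $F(\cdot,0)=0$. (3) $j:\mathbb{R}^N\times\mathbb{R}^N\to(-\infty,+\infty]$ is proper, convex, lower semicontinuous, $j(0,0)=0$ and $(0,0)\in\partial j(0,0)$, where $\partial j$ is the subdifferential in the sense of convex analysis. Functionals on $X_{T+2}$: $\Psi(u)=\sum_{n=1}^{T+1}\Phi[\Delta u(n-1)]$ if $\|\Delta u\|_\infty\le a$ and $\Psi(u)=+\infty$ otherwise; $J(u)=j(u(0),u(T+1))$; $\mathbf{F}(u)=-\sum_{n=1}^TF(n,u(n))$. $D(\Psi+J)=\{u\in X_{T+2}:\|\Delta u\|_\infty\le a,\ j(u(0),u(T+1))<+\infty\}$ is the effective domain of $\Psi+J$. A solution of the problem is a function $u\in X_{T+2}$ with $\|\Delta u\|_\infty<a$ and $\partial j(u(0),u(T+1))\neq\emptyset$ that satisfies both the equations and the boundary condition. *)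

theory Defs
  imports "HOL-Analysis.Analysis"
begin

definition strictly_convex_on :: "'a::real_vector set \<Rightarrow> ('a \<Rightarrow> real) \<Rightarrow> bool" where
  "strictly_convex_on S f \<longleftrightarrow> convex S \<and>
    (\<forall>x\<in>S. \<forall>y\<in>S. \<forall>s>0. \<forall>t>0. x \<noteq> y \<longrightarrow> s + t = 1 \<longrightarrow>
       f (s *\<^sub>R x + t *\<^sub>R y) < s * f x + t * f y)"

definition proper_fun :: "('a \<Rightarrow> ereal) \<Rightarrow> bool" where
  "proper_fun f \<longleftrightarrow> (\<forall>z. f z \<noteq> -\<infinity>) \<and> (\<exists>z. f z \<noteq> \<infinity>)"

text \<open>The right-hand side is the usual one for functions that never take the value minus
  infinity; a term with coefficient 0 vanishes, since \<^term>\<open>0 * \<infinity> = (0::ereal)\<close>.\<close>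

definition convex_fun :: "('a::real_vector \<Rightarrow> ereal) \<Rightarrow> bool" where
  "convex_fun f \<longleftrightarrow>
    (\<forall>x y. \<forall>s\<ge>0. \<forall>t\<ge>0. s + t = 1 \<longrightarrow>
       f (s *\<^sub>R x + t *\<^sub>R y) \<le> ereal s * f x + ereal t * f y)"

definition lsc_fun :: "('a::topological_space \<Rightarrow> ereal) \<Rightarrow> bool" where
  "lsc_fun f \<longleftrightarrow> (\<forall>z. f z \<le> Liminf (at z) f)"

text \<open>For a proper function the subdifferential is empty at every point where the function
  is infinite.\<close>

definition subdifferential :: "('a::real_inner \<Rightarrow> ereal) \<Rightarrow> 'a \<Rightarrow> 'a set" where
  "subdifferential f z = {\<zeta>. \<forall>w. f z + ereal (\<zeta> \<bullet> (w - z)) \<le> f w}"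

text \<open>Functions on the integer interval from 0 to T + 1 are represented by extensional
  functions, so that equality of elements of \<open>X_space T\<close> is equality of functions on that
  interval.\<close>

definition X_space :: "nat \<Rightarrow> (nat \<Rightarrow> real ^ 'n) set" where
  "X_space T = {0..T + 1} \<rightarrow>\<^sub>E UNIV"

definition fdiff :: "(nat \<Rightarrow> 'a::ab_group_add) \<Rightarrow> nat \<Rightarrow> 'a" where
  "fdiff u k = u (k + 1) - u k"

definition fdiff_norm :: "nat \<Rightarrow> (nat \<Rightarrow> real ^ 'n) \<Rightarrow> real" where
  "fdiff_norm T u = Max ((\<lambda>n. norm (fdiff u (n - 1))) ` {1..T + 1})"

definition mean :: "nat \<Rightarrow> (nat \<Rightarrow> real ^ 'n) \<Rightarrow> real ^ 'n" where
  "mean T v = (1 / real (T + 2)) *\<^sub>R (\<Sum>k = 0..T + 1. v k)"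

definition Psi_fun ::
  "nat \<Rightarrow> real \<Rightarrow> (real ^ 'n \<Rightarrow> real) \<Rightarrow> (nat \<Rightarrow> real ^ 'n) \<Rightarrow> ereal" where
  "Psi_fun T a \<Phi> u =
    (if fdiff_norm T u \<le> a then ereal (\<Sum>n = 1..T + 1. \<Phi> (fdiff u (n - 1))) else \<infinity>)"

definition J_fun ::
  "nat \<Rightarrow> ((real ^ 'n) \<times> (real ^ 'n) \<Rightarrow> ereal) \<Rightarrow> (nat \<Rightarrow> real ^ 'n) \<Rightarrow> ereal" where
  "J_fun T j u = j (u 0, u (T + 1))"

definition F_fun :: "nat \<Rightarrow> (nat \<Rightarrow> real ^ 'n \<Rightarrow> real) \<Rightarrow> (nat \<Rightarrow> real ^ 'n) \<Rightarrow> real" where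
  "F_fun T F u = - (\<Sum>n = 1..T. F n (u n))"

definition energy ::
  "nat \<Rightarrow> real \<Rightarrow> (real ^ 'n \<Rightarrow> real) \<Rightarrow> (nat \<Rightarrow> real ^ 'n \<Rightarrow> real) \<Rightarrow>
    ((real ^ 'n) \<times> (real ^ 'n) \<Rightarrow> ereal) \<Rightarrow> (nat \<Rightarrow> real ^ 'n) \<Rightarrow> ereal" where
  "energy T a \<Phi> F j u = Psi_fun T a \<Phi> u + J_fun T j u + ereal (F_fun T F u)"

definition eff_dom ::
  "nat \<Rightarrow> real \<Rightarrow> ((real ^ 'n) \<times> (real ^ 'n) \<Rightarrow> ereal) \<Rightarrow> (nat \<Rightarrow> real ^ 'n) set" where
  "eff_dom T a j = {u \<in> X_space T. fdiff_norm T u \<le> a \<and> j (u 0, u (T + 1)) < \<infinity>}"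

definition eff_dom_mean ::
  "nat \<Rightarrow> real \<Rightarrow> ((real ^ 'n) \<times> (real ^ 'n) \<Rightarrow> ereal) \<Rightarrow> real \<Rightarrow> (nat \<Rightarrow> real ^ 'n) set" where
  "eff_dom_mean T a j \<delta> = {v \<in> eff_dom T a j. norm (mean T v) \<le> \<delta>}"

text \<open>Here \<open>gradF n\<close> stands for the gradient of \<open>F n\<close>. The left-hand side of the equation is
  minus the forward difference, at n - 1, of the sequence k \<mapsto> \<phi> (fdiff u k).\<close>

definition is_solution ::
  "nat \<Rightarrow> real \<Rightarrow> (real ^ 'n \<Rightarrow> real ^ 'n) \<Rightarrow> (nat \<Rightarrow> real ^ 'n \<Rightarrow> real ^ 'n) \<Rightarrow>
    ((real ^ 'n) \<times> (real ^ 'n) \<Rightarrow> ereal) \<Rightarrow> (nat \<Rightarrow> real ^ 'n) \<Rightarrow> bool" where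
  "is_solution T a \<phi> gradF j u \<longleftrightarrow>
    u \<in> X_space T \<and>
    fdiff_norm T u < a \<and>
    subdifferential j (u 0, u (T + 1)) \<noteq> {} \<and>
    (\<forall>n\<in>{1..T}. - fdiff (\<lambda>k. \<phi> (fdiff u k)) (n - 1) = gradF n (u n)) \<and>
    (\<phi> (fdiff u 0), - \<phi> (fdiff u T)) \<in> subdifferential j (u 0, u (T + 1))"

end

theory Submission
  imports Defs
begin

text \<open>A minimizer exists on the set of \<open>v\<close> with \<open>norm (mean T v) \<le> \<delta>\<close>: steps bounded by \<open>a\<close> and a
  bounded mean confine \<open>v\<close> to a compact set (\<open>compact_bounded_steps_and_mean\<close>), and the energy is
  there the sum of the lower semicontinuous term \<open>j (v 0, v (T + 1))\<close> and a continuous real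
  function. By the equality of the two infima, this minimizer \<open>u\<close> minimizes the energy over the
  whole effective domain, hence over all functions. It remains to see that a global minimizer is a
  solution, and for this \<open>u\<close> is compared with the points \<open>u + t (w - u)\<close> of segments, as \<open>t\<close>
  decreases to 0; along a segment \<open>j\<close> is controlled by convexity (\<open>minimizer_segment_ineq\<close>).

  With \<open>w = 0\<close> one finds that no step of \<open>u\<close> has norm \<open>a\<close> (\<open>minimizer_steps_interior\<close>). Indeed
  \<open>\<phi>\<close> is a homeomorphism of the ball onto the whole space, so \<open>norm (\<phi> z)\<close> tends to infinity
  as \<open>norm z\<close> tends to \<open>a\<close>, and by convexity the radial slope of \<open>\<Phi>\<close> is infinite at the boundary sphere
  (\<open>boundary_slope_infinite\<close>). Shrinking \<open>u\<close> by the factor \<open>1 - t\<close> would therefore gain more in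
  \<open>\<Phi>\<close> than any multiple of \<open>t\<close>; the term \<open>j\<close> and the other values of \<open>\<Phi>\<close> do not increase,
  because both functions are convex with minimum 0 at the origin, and the change of the potential
  \<open>F\<close> is only of order \<open>t\<close>.

  As the steps of \<open>u\<close> are interior, the constraint on the steps is inactive near \<open>u\<close>, and every
  \<open>w\<close> with \<open>j (w 0, w (T + 1))\<close> finite is admissible for small \<open>t\<close>. Differentiating at
  \<open>t = 0\<close> gives the variational inequality \<open>minimizer_variational_ineq\<close>. Changing \<open>u\<close> at one
  inner point turns it into the difference equation, and changing \<open>u\<close> at the two end points turns
  it into the subgradient inequality at the boundary (\<open>variational_ineq_imp_solution\<close>).\<close>

section \<open>Lower semicontinuous functions on compact sets\<close>

lemma closed_epigraph:
  fixes f :: "'a::topological_space \<Rightarrow> ereal"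
  assumes "lsc_fun f"
  shows "closed {(z, s :: real). f z \<le> ereal s}"
proof -
  have "\<exists>W. open W \<and> p \<in> W \<and> W \<subseteq> {(z, s). ereal s < f z}"
    if "p \<in> {(z, s). ereal s < f z}" for p :: "'a \<times> real"
  proof -
    obtain z s where p: "p = (z, s)" and lt: "ereal s < f z"
      using \<open>p \<in> _\<close> by auto
    obtain r where r: "ereal s < ereal r" "ereal r < f z"
      using ereal_dense2[OF lt] by blast
    have "ereal r < Liminf (at z) f"
      using r assms unfolding lsc_fun_def by (meson less_le_trans)
    then have "\<forall>\<^sub>F w in at z. ereal r < f w"
      by (rule less_LiminfD)
    then obtain U where U: "open U" "z \<in> U" "\<And>w. w \<in> U \<Longrightarrow> w \<noteq> z \<Longrightarrow> ereal r < f w"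
      unfolding eventually_at_topological by blast
    have "ereal q < f w" if "w \<in> U" "q < r" for w q
    proof -
      have "ereal r < f w"
        using U(3)[OF \<open>w \<in> U\<close>] r(2) by (cases "w = z") auto
      then show ?thesis
        using that(2) by (meson less_ereal.simps(1) less_trans)
    qed
    then have "U \<times> {..<r} \<subseteq> {(z, s). ereal s < f z}" by auto
    moreover have "open (U \<times> {..<r})" "p \<in> U \<times> {..<r}"
      using U r p by (auto intro: open_Times)
    ultimately show ?thesis by blast
  qed
  then have "open {(z, s :: real). ereal s < f z}"
    by (subst open_subopen) blast
  moreover have "- {(z, s :: real). f z \<le> ereal s} = {(z, s). ereal s < f z}"
    by auto
  ultimately show ?thesis
    by (simp add: closed_def)
qed

lemma lsc_plus_continuous_attains_inf:
  fixes K :: "'a::t2_space set" and p :: "'a \<Rightarrow> 'b::topological_space" and g :: "'a \<Rightarrow> real"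
  assumes K: "compact K" "K \<noteq> {}" and p: "continuous_on K p" and g: "continuous_on K g"
    and j: "lsc_fun j"
  shows "\<exists>u\<in>K. \<forall>v\<in>K. j (p u) + ereal (g u) \<le> j (p v) + ereal (g v)"
proof -
  define val where "val u = j (p u) + ereal (g u)" for u
  define S where "S c = {u \<in> K. val u \<le> ereal c}" for c
  define C where "C = {c. \<exists>v\<in>K. val v < ereal c}"
  have "closed (S c)" for c
  proof -
    have "val u \<le> ereal c \<longleftrightarrow> j (p u) \<le> ereal (c - g u)" for u
      unfolding val_def by (cases "j (p u)") auto
    then have "S c = K \<inter> (\<lambda>u. (p u, c - g u)) -` {(z, s). j z \<le> ereal s}"
      unfolding S_def by auto
    moreover have "continuous_on K (\<lambda>u. (p u, c - g u))"
      by (intro continuous_intros p g)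
    ultimately show ?thesis
      using continuous_closed_preimage[OF _ compact_imp_closed[OF K(1)] closed_epigraph[OF j]]
      by metis
  qed
  moreover have "K \<inter> (\<Inter>c\<in>C'. S c) \<noteq> {}" if C': "finite C'" "C' \<subseteq> C" for C'
  proof (cases "C' = {}")
    case True
    then show ?thesis using K by simp
  next
    case False
    then have "Min C' \<in> C"
      using C' Min_in by blast
    then obtain v where v: "v \<in> K" "val v < ereal (Min C')"
      unfolding C_def by blast
    have "v \<in> S c" if "c \<in> C'" for c
    proof -
      have "ereal (Min C') \<le> ereal c"
        using C' that by simp
      then have "val v \<le> ereal c"
        using v(2) by order
      then show ?thesis
        using v(1) unfolding S_def by simp
    qed
    then show ?thesis using v by blast
  qed
  ultimately have "K \<inter> (\<Inter>c\<in>C. S c) \<noteq> {}"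
    by (rule compact_imp_fip_image[OF K(1)])
  \<comment> \<open>A common point of the nonempty compact sublevel sets is a minimizer; if \<open>C\<close> is empty, the
    value is infinite on all of \<open>K\<close> and any point will do.\<close>
  then obtain u where u: "u \<in> K" "\<And>c. c \<in> C \<Longrightarrow> u \<in> S c"
    by blast
  have "val u \<le> val v" if "v \<in> K" for v
  proof (rule ccontr)
    assume "\<not> val u \<le> val v"
    then obtain c where c: "val v < ereal c" "ereal c < val u"
      using ereal_dense2 by (metis not_le)
    then have "c \<in> C"
      using that unfolding C_def by blast
    then show False
      using u(2)[of c] c unfolding S_def by auto
  qed
  then show ?thesis
    using u unfolding val_def by blast
qed

section \<open>Gradients of convex functions\<close>

lemma has_real_derivative_along_line:
  fixes f :: "'a::real_inner \<Rightarrow> real"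
  assumes "GDERIV f x :> D"
  shows "((\<lambda>t. f (x + t *\<^sub>R d)) has_real_derivative (D \<bullet> d)) (at 0)"
proof -
  have l: "((\<lambda>t. x + t *\<^sub>R d) has_derivative (\<lambda>t. t *\<^sub>R d)) (at (0::real))"
    by (auto intro!: derivative_eq_intros)
  have "(f has_derivative (\<lambda>h. h \<bullet> D)) (at (x + 0 *\<^sub>R d))"
    using assms by (simp add: gderiv_def)
  from has_derivative_compose[OF l this]
  show ?thesis
    by (simp add: has_field_derivative_def inner_commute mult_commute_abs)
qed

lemma derivative_nonneg_at_right_minimum:
  fixes h :: "real \<Rightarrow> real"
  assumes D: "(h has_real_derivative D) (at 0)" and e: "e > 0"
    and h: "\<And>t. 0 < t \<Longrightarrow> t < e \<Longrightarrow> h 0 \<le> h t"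
  shows "D \<ge> 0"
proof (rule ccontr)
  assume "\<not> D \<ge> 0"
  then obtain d where d: "d > 0" "\<And>t. t > 0 \<Longrightarrow> 0 + t \<in> UNIV \<Longrightarrow> t < d \<Longrightarrow> h (0 + t) < h 0"
    using has_real_derivative_neg_dec_right[OF D] by force
  obtain t where "0 < t" "t < min d e"
    using d(1) e dense[of 0 "min d e"] by auto
  then show False
    using d(2)[of t] h[of t] by simp
qed

lemma strictly_convex_on_imp_convex_on:
  assumes "strictly_convex_on S f"
  shows "convex_on S f"
proof (rule convex_onI)
  fix t x y assume *: "(0::real) < t" "t < 1" "x \<in> S" "y \<in> S"
  show "f ((1 - t) *\<^sub>R x + t *\<^sub>R y) \<le> (1 - t) * f x + t * f y"
  proof (cases "x = y")
    case True
    then show ?thesis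
      by (simp add: algebra_simps flip: scaleR_add_left)
  next
    case False
    have "f ((1 - t) *\<^sub>R x + t *\<^sub>R y) < (1 - t) * f x + t * f y"
      using assms[unfolded strictly_convex_on_def, THEN conjunct2, rule_format, of x y "1 - t" t]
        * False by simp
    then show ?thesis by simp
  qed
qed (use assms in \<open>simp add: strictly_convex_on_def\<close>)

lemma convex_gradient_inequality:
  fixes f :: "'a::real_inner \<Rightarrow> real"
  assumes f: "convex_on S f" and "x \<in> S" "y \<in> S" and D: "GDERIV f x :> D"
  shows "f x + D \<bullet> (y - x) \<le> f y"
proof -
  define h where "h t = (1 - t) * f x + t * f y - f (x + t *\<^sub>R (y - x))" for t
  have "(h has_real_derivative (f y - f x - D \<bullet> (y - x))) (at 0)"
    unfolding h_def
    by (auto intro!: derivative_eq_intros has_real_derivative_along_line[OF D])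
  moreover have "h 0 \<le> h t" if "0 < t" "t < 1" for t
  proof -
    have "f ((1 - t) *\<^sub>R x + t *\<^sub>R y) \<le> (1 - t) * f x + t * f y"
      using convex_onD[OF f] assms(2,3) that by simp
    moreover have "(1 - t) *\<^sub>R x + t *\<^sub>R y = x + t *\<^sub>R (y - x)"
      by (simp add: algebra_simps)
    ultimately show ?thesis
      unfolding h_def by simp
  qed
  ultimately have "0 \<le> f y - f x - D \<bullet> (y - x)"
    by (rule derivative_nonneg_at_right_minimum[OF _ zero_less_one])
  then show ?thesis by simp
qed

section \<open>Infinite slope at the boundary of the ball\<close>

text \<open>The preimage of a closed ball under \<open>\<phi>\<close> is compact, so it stays away from the boundary
  sphere.\<close>
lemma homeomorphism_ball_escape:
  fixes \<phi> :: "'a::euclidean_space \<Rightarrow> 'b::euclidean_space"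
  assumes "homeomorphism (ball 0 a) UNIV \<phi> \<psi>" "a > 0"
  shows "\<exists>r<a. \<forall>z\<in>ball 0 a. r < norm z \<longrightarrow> R < norm (\<phi> z)"
proof -
  have c: "compact (\<psi> ` cball 0 \<bar>R\<bar>)"
  proof (rule compact_continuous_image)
    show "continuous_on (cball 0 \<bar>R\<bar>) \<psi>"
      using assms unfolding homeomorphism_def by (meson continuous_on_subset subset_UNIV)
  qed simp
  have ne: "\<psi> ` cball 0 \<bar>R\<bar> \<noteq> {}" by simp
  have "continuous_on (\<psi> ` cball 0 \<bar>R\<bar>) norm"
    by (rule continuous_on_norm) (rule continuous_on_id)
  from continuous_attains_sup[OF c ne this]
  obtain z0 where z0: "z0 \<in> \<psi> ` cball 0 \<bar>R\<bar>" "\<And>z. z \<in> \<psi> ` cball 0 \<bar>R\<bar> \<Longrightarrow> norm z \<le> norm z0"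
    by blast
  have "norm z0 < a"
    using z0(1) assms unfolding homeomorphism_def by auto
  moreover have "R < norm (\<phi> z)" if "z \<in> ball 0 a" "norm z0 < norm z" for z
  proof (rule ccontr)
    assume "\<not> R < norm (\<phi> z)"
    then have "\<phi> z \<in> cball 0 \<bar>R\<bar>" by simp
    moreover have "z = \<psi> (\<phi> z)"
      using assms that unfolding homeomorphism_def by auto
    ultimately have "norm z \<le> norm z0"
      using z0(2) by blast
    then show False using that by simp
  qed
  ultimately show ?thesis by blast
qed

text \<open>At a boundary point \<open>x\<close>, the difference quotient of \<open>\<Phi>\<close> in the direction of the centre
  tends to minus infinity: it is eventually at most \<open>- L\<close>, for any \<open>L\<close>.\<close>
lemma boundary_slope_infinite:
  fixes \<phi> :: "'a::euclidean_space \<Rightarrow> 'a" and \<Phi> :: "'a \<Rightarrow> real"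
  assumes a: "a > 0" and homeo: "homeomorphism (ball 0 a) UNIV \<phi> \<psi>"
    and grad: "\<And>x. x \<in> ball 0 a \<Longrightarrow> GDERIV \<Phi> x :> \<phi> x"
    and cont: "continuous_on (cball 0 a) \<Phi>"
    and conv: "convex_on (cball 0 a) \<Phi>"
    and x: "norm x = a"
  shows "\<forall>\<^sub>F t in at_right 0. t * L \<le> \<Phi> x - \<Phi> ((1 - t) *\<^sub>R x)"
proof -
  have "compact (\<Phi> ` cball 0 a)"
    using cont by (intro compact_continuous_image) auto
  then have "bounded (\<Phi> ` cball 0 a)"
    by (rule compact_imp_bounded)
  then obtain M where M: "\<And>y. y \<in> cball 0 a \<Longrightarrow> \<bar>\<Phi> y\<bar> \<le> M"
    unfolding bounded_real by (metis image_eqI)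
  define l where "l = max L 0"
  obtain r where r: "r < a" "\<And>z. z \<in> ball 0 a \<Longrightarrow> r < norm z \<Longrightarrow> 2 * (l + 2 * M) / a < norm (\<phi> z)"
    using homeomorphism_ball_escape[OF homeo a] by blast
  have "t * L \<le> \<Phi> x - \<Phi> ((1 - t) *\<^sub>R x)" if t: "0 < t" "t < min 1 (1 - r / a)" for t
  proof -
    define z where "z = (1 - t) *\<^sub>R x"
    have nz: "norm z = (1 - t) * a"
      using t x by (simp add: z_def)
    have zb: "z \<in> ball 0 a"
      using nz t a by simp
    have "r / a < 1 - t" using t by simp
    then have "r < norm z"
      using nz a by (simp add: field_simps)
    from r(2)[OF zb this] have big: "l + 2 * M < a / 2 * norm (\<phi> z)"
      using a by (simp add: field_simps)
    have "0 \<le> M" using M[of 0] a by force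
    then have pos: "norm (\<phi> z) > 0"
      using big a unfolding l_def by (cases "\<phi> z = 0") auto
    \<comment> \<open>Testing convexity at half radius in the direction of \<open>\<phi> z\<close> bounds the radial
      component of \<open>\<phi> z\<close> below by a multiple of its norm.\<close>
    define y where "y = (a / 2 / norm (\<phi> z)) *\<^sub>R \<phi> z"
    have yb: "y \<in> cball 0 a"
      using a pos by (simp add: y_def)
    have "\<phi> z \<bullet> y = a / 2 * norm (\<phi> z)"
      using pos by (simp add: y_def dot_square_norm power2_eq_square)
    moreover have "\<Phi> z + \<phi> z \<bullet> (y - z) \<le> \<Phi> y"
      using convex_gradient_inequality[OF conv _ yb grad[OF zb]] zb by simp
    moreover have "\<bar>\<Phi> y\<bar> \<le> M" "\<bar>\<Phi> z\<bar> \<le> M"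
      using M yb zb by auto
    ultimately have "l \<le> \<phi> z \<bullet> z"
      using big by (simp add: inner_diff_right)
    also have "\<dots> = (1 - t) * (\<phi> z \<bullet> x)"
      by (simp add: z_def)
    finally have "l \<le> (1 - t) * (\<phi> z \<bullet> x)" .
    moreover have "(1 - t) * l \<le> l"
      using t unfolding l_def by (intro mult_left_le_one_le) auto
    ultimately have "(1 - t) * l \<le> (1 - t) * (\<phi> z \<bullet> x)"
      by (rule order_trans[rotated])
    then have "l \<le> \<phi> z \<bullet> x"
      using t by simp
    then have "t * L \<le> t * (\<phi> z \<bullet> x)"
      using t unfolding l_def by simp
    also have "\<dots> = \<phi> z \<bullet> (x - z)"
      by (simp add: z_def algebra_simps)
    also have "\<dots> \<le> \<Phi> x - \<Phi> z"
      using convex_gradient_inequality[OF conv _ _ grad[OF zb], of x] zb x by simp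
    finally show ?thesis by (simp add: z_def)
  qed
  moreover have "min 1 (1 - r / a) > 0"
    using r a by (simp add: field_simps)
  ultimately show ?thesis
    unfolding eventually_at_right_field by blast
qed

section \<open>The energy functional\<close>

lemma fdiff_norm_image:
  "(\<lambda>n. norm (fdiff u (n - 1))) ` {1..T + 1} = (\<lambda>k. norm (fdiff u k)) ` {..T}"
proof -
  have "{1..T + 1} = Suc ` {..T}"
    by (simp add: image_Suc_atMost)
  then show ?thesis
    by (simp add: image_image)
qed

lemma fdiff_norm_le_iff: "fdiff_norm T u \<le> c \<longleftrightarrow> (\<forall>k\<le>T. norm (fdiff u k) \<le> c)"
  unfolding fdiff_norm_def fdiff_norm_image by auto

lemma fdiff_norm_less_iff: "fdiff_norm T u < c \<longleftrightarrow> (\<forall>k\<le>T. norm (fdiff u k) < c)"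
  unfolding fdiff_norm_def fdiff_norm_image by auto

text \<open>The part of the energy other than \<open>j\<close>. It is meaningful only when all steps of \<open>u\<close> lie in the
  closed ball of radius \<open>a\<close>, where the energy is this real number plus \<open>j (u 0, u (T + 1))\<close>. The
  steps are indexed by \<open>k \<le> T\<close>, that is by \<open>k = n - 1\<close>.\<close>
definition finite_energy ::
  "nat \<Rightarrow> (real ^ 'n \<Rightarrow> real) \<Rightarrow> (nat \<Rightarrow> real ^ 'n \<Rightarrow> real) \<Rightarrow> (nat \<Rightarrow> real ^ 'n) \<Rightarrow> real" where
  "finite_energy T \<Phi> F u = (\<Sum>k\<le>T. \<Phi> (fdiff u k)) - (\<Sum>n = 1..T. F n (u n))"

lemma energy_eq:
  assumes "fdiff_norm T u \<le> a"
  shows "energy T a \<Phi> F j u = j (u 0, u (T + 1)) + ereal (finite_energy T \<Phi> F u)"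
proof -
  have "(\<Sum>n = 1..T + 1. \<Phi> (fdiff u (n - 1))) = (\<Sum>k\<le>T. \<Phi> (fdiff u k))"
    using sum.shift_bounds_cl_Suc_ivl[of "\<lambda>n. \<Phi> (fdiff u (n - 1))" 0 T]
    by (simp add: atMost_atLeast0)
  then have "energy T a \<Phi> F j u = ereal (\<Sum>k\<le>T. \<Phi> (fdiff u k)) + j (u 0, u (T + 1))
      + ereal (- (\<Sum>n = 1..T. F n (u n)))"
    using assms unfolding energy_def Psi_fun_def J_fun_def F_fun_def by simp
  then show ?thesis
    unfolding finite_energy_def by (cases "j (u 0, u (T + 1))") simp_all
qed

lemma energy_eq_top:
  assumes "\<not> fdiff_norm T u \<le> a" "j (u 0, u (T + 1)) \<noteq> -\<infinity>"
  shows "energy T a \<Phi> F j u = \<infinity>"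
  using assms unfolding energy_def Psi_fun_def J_fun_def by simp

lemma energy_eq_top_outside_eff_dom:
  assumes "u \<in> X_space T" "u \<notin> eff_dom T a j" "proper_fun j"
  shows "energy T a \<Phi> F j u = \<infinity>"
proof (cases "fdiff_norm T u \<le> a")
  case True
  then have "j (u 0, u (T + 1)) = \<infinity>"
    using assms unfolding eff_dom_def by simp
  then show ?thesis
    using energy_eq[OF True] by simp
next
  case False
  then show ?thesis
    using assms energy_eq_top unfolding proper_fun_def by blast
qed

text \<open>The energy sees only the values on the interval from 0 to \<open>T + 1\<close>. Competitors therefore need
  not be extensional.\<close>
lemma energy_restrict: "energy T a \<Phi> F j (restrict u {0..T + 1}) = energy T a \<Phi> F j u"
proof -
  have d: "fdiff (restrict u {0..T + 1}) (n - 1) = fdiff u (n - 1)" if "n \<in> {1..T + 1}" for n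
    using that unfolding fdiff_def by auto
  have "fdiff_norm T (restrict u {0..T + 1}) = fdiff_norm T u"
    unfolding fdiff_norm_def by (intro arg_cong[where f = Max] image_cong) (simp_all only: d)
  moreover have "(\<Sum>n = 1..T + 1. \<Phi> (fdiff (restrict u {0..T + 1}) (n - 1)))
      = (\<Sum>n = 1..T + 1. \<Phi> (fdiff u (n - 1)))"
    using d by (intro sum.cong) auto
  ultimately show ?thesis
    unfolding energy_def Psi_fun_def J_fun_def F_fun_def by simp
qed

section \<open>Existence of a minimizer with bounded mean\<close>

lemma norm_diff_le_steps:
  fixes v :: "nat \<Rightarrow> 'a::real_normed_vector"
  assumes "\<And>k. k \<le> T \<Longrightarrow> norm (fdiff v k) \<le> a" "l \<le> k" "k \<le> T + 1"
  shows "norm (v k - v l) \<le> real (k - l) * a"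
  using assms(2,3)
proof (induction k rule: dec_induct)
  case (step k)
  have "norm (v (Suc k) - v l) \<le> norm (fdiff v k) + norm (v k - v l)"
    using norm_triangle_ineq[of "fdiff v k" "v k - v l"] by (simp add: fdiff_def)
  also have "\<dots> \<le> a + real (k - l) * a"
    using step assms(1)[of k] by simp
  also have "\<dots> = real (Suc k - l) * a"
    using step by (simp add: Suc_diff_le algebra_simps)
  finally show ?case .
qed simp

lemma norm_le_of_mean:
  fixes v :: "nat \<Rightarrow> real ^ 'n"
  assumes "fdiff_norm T v \<le> a" "norm (mean T v) \<le> \<delta>" "a \<ge> 0" "k \<le> T + 1"
  shows "norm (v k) \<le> \<delta> + real (T + 1) * a"
proof -
  have steps: "norm (v k - v l) \<le> real (T + 1) * a" if "l \<le> T + 1" for l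
  proof -
    have "norm (v k - v l) \<le> real (max k l - min k l) * a"
      using norm_diff_le_steps[of T v a "min k l" "max k l"] assms(1,4) that
      by (cases "k \<le> l") (auto simp: fdiff_norm_le_iff norm_minus_commute max_def min_def)
    also have "\<dots> \<le> real (T + 1) * a"
      using assms(3,4) that by (intro mult_right_mono) auto
    finally show ?thesis .
  qed
  have "real (T + 2) *\<^sub>R (v k - mean T v) = (\<Sum>l = 0..T + 1. v k - v l)"
    unfolding mean_def by (simp add: sum_subtractf scaleR_diff_right sum_constant_scaleR del: sum_constant sum.cl_ivl_Suc)
  then have "real (T + 2) * norm (v k - mean T v) = norm (\<Sum>l = 0..T + 1. v k - v l)"
    by (metis abs_of_nat norm_scaleR)
  also have "\<dots> \<le> (\<Sum>l = 0..T + 1. real (T + 1) * a)"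
    using steps by (intro sum_norm_le) auto
  also have "\<dots> = real (T + 2) * (real (T + 1) * a)"
    by simp
  finally have "norm (v k - mean T v) \<le> real (T + 1) * a"
    by (simp only: mult_le_cancel_left_pos of_nat_0_less_iff)
  then show ?thesis
    using assms(2) norm_triangle_sub[of "v k" "mean T v"] by simp
qed

text \<open>Compactness is that of the product topology on all functions from the naturals; outside the
  interval from 0 to \<open>T + 1\<close> the factors are singletons, by extensionality.\<close>
lemma compact_bounded_steps_and_mean:
  assumes "a \<ge> 0"
  shows "compact {v :: nat \<Rightarrow> real ^ 'n. v \<in> X_space T \<and> fdiff_norm T v \<le> a \<and> norm (mean T v) \<le> \<delta>}"
    (is "compact ?K")
proof -
  define S :: "nat \<Rightarrow> (real ^ 'n) set" where
    "S i = (if i \<le> T + 1 then cball 0 (\<delta> + real (T + 1) * a) else {undefined})" for i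
  have "compactin (product_topology (\<lambda>i. euclidean) UNIV) (PiE UNIV S)"
    unfolding compactin_PiE S_def by auto
  then have c: "compact (PiE UNIV S)"
    by (simp add: euclidean_product_topology)
  have d: "closed {v :: nat \<Rightarrow> real ^ 'n. (\<forall>k. k \<le> T \<longrightarrow> norm (fdiff v k) \<le> a) \<and> norm (mean T v) \<le> \<delta>}"
    unfolding fdiff_def mean_def
    by (intro closed_Collect_conj closed_Collect_all closed_Collect_imp open_Collect_const
        closed_Collect_le continuous_intros) auto
  have "?K = PiE UNIV S \<inter> {v. (\<forall>k. k \<le> T \<longrightarrow> norm (fdiff v k) \<le> a) \<and> norm (mean T v) \<le> \<delta>}"
  proof (intro set_eqI iffI)
    fix v assume v: "v \<in> ?K"
    then have "v i \<in> S i" for i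
      using norm_le_of_mean[of T v a \<delta> i] assms
      unfolding S_def X_space_def PiE_def extensional_def by auto
    then show "v \<in> PiE UNIV S \<inter> {v. (\<forall>k. k \<le> T \<longrightarrow> norm (fdiff v k) \<le> a) \<and> norm (mean T v) \<le> \<delta>}"
      using v by (auto simp: fdiff_norm_le_iff)
  next
    fix v assume v: "v \<in> PiE UNIV S \<inter> {v. (\<forall>k. k \<le> T \<longrightarrow> norm (fdiff v k) \<le> a) \<and> norm (mean T v) \<le> \<delta>}"
    then have "v i \<in> S i" for i by auto
    then have "v i = undefined" if "i \<notin> {0..T + 1}" for i
      using that unfolding S_def by (metis atLeastAtMost_iff le0 singletonD)
    then show "v \<in> ?K"
      using v unfolding X_space_def PiE_def extensional_def by (auto simp: fdiff_norm_le_iff)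
  qed
  with compact_Int_closed[OF c d] show ?thesis
    by simp
qed

lemma energy_attains_inf_on_eff_dom_mean:
  fixes \<Phi> :: "real ^ 'n \<Rightarrow> real"
  assumes "a \<ge> 0" "\<delta> \<ge> 0" and Phi: "continuous_on (cball 0 a) \<Phi>"
    and F: "\<And>n. n \<in> {1..T} \<Longrightarrow> continuous_on UNIV (F n)"
    and j: "lsc_fun j" "j (0, 0) \<noteq> \<infinity>"
  shows "\<exists>u\<in>eff_dom_mean T a j \<delta>. \<forall>v\<in>eff_dom_mean T a j \<delta>.
    energy T a \<Phi> F j u \<le> energy T a \<Phi> F j v"
proof -
  define K where "K = {v :: nat \<Rightarrow> real ^ 'n.
    v \<in> X_space T \<and> fdiff_norm T v \<le> a \<and> norm (mean T v) \<le> \<delta>}"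
  define o' :: "nat \<Rightarrow> real ^ 'n" where "o' = restrict (\<lambda>_. 0) {0..T + 1}"
  have o: "o' \<in> K"
    using assms(1,2) unfolding K_def o'_def X_space_def fdiff_norm_le_iff mean_def fdiff_def by auto
  have coord: "continuous_on K (\<lambda>v. v k)" for k
    by (rule continuous_on_subset[OF continuous_on_product_coordinates]) simp
  have "continuous_on K (\<lambda>v. \<Phi> (fdiff v k))" if "k \<le> T" for k
  proof (rule continuous_on_compose2[OF Phi])
    show "continuous_on K (\<lambda>v. fdiff v k)"
      unfolding fdiff_def by (intro continuous_intros coord)
    show "(\<lambda>v. fdiff v k) ` K \<subseteq> cball 0 a"
      using that unfolding K_def by (auto simp: fdiff_norm_le_iff)
  qed
  moreover have "continuous_on K (\<lambda>v. F n (v n))" if "n \<in> {1..T}" for n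
    using continuous_on_compose2[OF F[OF that] coord] by simp
  ultimately have "continuous_on K (finite_energy T \<Phi> F)"
    unfolding finite_energy_def[abs_def] by (intro continuous_intros) auto
  moreover have "continuous_on K (\<lambda>v. (v 0, v (T + 1)))"
    by (intro continuous_intros coord)
  moreover have "compact K"
    unfolding K_def by (rule compact_bounded_steps_and_mean[OF assms(1)])
  ultimately obtain u where u: "u \<in> K"
    and min: "\<And>v. v \<in> K \<Longrightarrow> j (u 0, u (T + 1)) + ereal (finite_energy T \<Phi> F u)
      \<le> j (v 0, v (T + 1)) + ereal (finite_energy T \<Phi> F v)"
    using lsc_plus_continuous_attains_inf[of K "\<lambda>v. (v 0, v (T + 1))" "finite_energy T \<Phi> F" j] o j
    by blast
  \<comment> \<open>The zero function has finite energy, so the minimum is finite.\<close>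
  have "j (o' 0, o' (T + 1)) = j (0, 0)"
    by (simp add: o'_def)
  then have "j (u 0, u (T + 1)) < \<infinity>"
    using min[OF o] j(2) by (cases "j (0, 0)"; cases "j (u 0, u (T + 1))") auto
  then have "u \<in> eff_dom_mean T a j \<delta>"
    using u unfolding K_def eff_dom_mean_def eff_dom_def by simp
  moreover have "energy T a \<Phi> F j u \<le> energy T a \<Phi> F j v" if "v \<in> eff_dom_mean T a j \<delta>" for v
    using that u min[of v] unfolding K_def eff_dom_mean_def eff_dom_def by (simp add: energy_eq)
  ultimately show ?thesis by blast
qed

section \<open>Minimizers are solutions\<close>

lemma fdiff_segment:
  fixes u w :: "nat \<Rightarrow> 'a::real_vector"
  shows "fdiff (\<lambda>k. u k + t *\<^sub>R (w k - u k)) k = fdiff u k + t *\<^sub>R (fdiff w k - fdiff u k)"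
  unfolding fdiff_def by (simp add: algebra_simps)

text \<open>By convexity, passing from \<open>u\<close> to \<open>u + t (w - u)\<close> raises \<open>j\<close> by at most \<open>t\<close> times the
  difference \<open>jw - ju\<close> of the end values.\<close>
lemma minimizer_segment_ineq:
  assumes min: "\<And>v. energy T a \<Phi> F j u \<le> energy T a \<Phi> F j v"
    and u: "fdiff_norm T u \<le> a" "j (u 0, u (T + 1)) = ereal ju"
    and w: "j (w 0, w (T + 1)) = ereal jw"
    and j: "convex_fun j" "proper_fun j"
    and t: "0 \<le> t" "t \<le> 1"
    and small: "\<And>k. k \<le> T \<Longrightarrow> norm (fdiff u k + t *\<^sub>R (fdiff w k - fdiff u k)) \<le> a"
  shows "finite_energy T \<Phi> F u
    \<le> t * (jw - ju) + finite_energy T \<Phi> F (\<lambda>k. u k + t *\<^sub>R (w k - u k))"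
proof -
  define v where "v = (\<lambda>k. u k + t *\<^sub>R (w k - u k))"
  have vd: "fdiff_norm T v \<le> a"
    using small unfolding v_def fdiff_norm_le_iff fdiff_segment by simp
  have "(v 0, v (T + 1)) = (1 - t) *\<^sub>R (u 0, u (T + 1)) + t *\<^sub>R (w 0, w (T + 1))"
    unfolding v_def by (simp add: algebra_simps)
  moreover have "j ((1 - t) *\<^sub>R (u 0, u (T + 1)) + t *\<^sub>R (w 0, w (T + 1)))
      \<le> ereal (1 - t) * j (u 0, u (T + 1)) + ereal t * j (w 0, w (T + 1))"
    using j(1) t unfolding convex_fun_def by simp
  ultimately have "j (v 0, v (T + 1)) \<le> ereal ((1 - t) * ju + t * jw)"
    using u(2) w by simp
  moreover have "j (v 0, v (T + 1)) \<noteq> -\<infinity>"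
    using j(2) unfolding proper_fun_def by blast
  moreover have "ereal ju + ereal (finite_energy T \<Phi> F u)
      \<le> j (v 0, v (T + 1)) + ereal (finite_energy T \<Phi> F v)"
    using min[of v] energy_eq[OF u(1)] energy_eq[OF vd] u(2) by metis
  ultimately have "finite_energy T \<Phi> F u \<le> t * (jw - ju) + finite_energy T \<Phi> F v"
    by (cases "j (v 0, v (T + 1))") (auto simp: algebra_simps)
  then show ?thesis unfolding v_def .
qed

lemma minimizer_steps_interior:
  fixes \<phi> :: "real ^ 'n \<Rightarrow> real ^ 'n"
  assumes a: "a > 0" and homeo: "homeomorphism (ball 0 a) UNIV \<phi> \<psi>"
    and phi_0: "\<phi> 0 = 0"
    and Phi_grad: "\<And>x. x \<in> ball 0 a \<Longrightarrow> GDERIV \<Phi> x :> \<phi> x"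
    and Phi_cont: "continuous_on (cball 0 a) \<Phi>"
    and Phi_conv: "convex_on (cball 0 a) \<Phi>"
    and Phi_0: "\<Phi> 0 = 0"
    and F_grad: "\<And>n x. n \<in> {1..T} \<Longrightarrow> GDERIV (F n) x :> gradF n x"
    and j: "convex_fun j" "proper_fun j" "j (0, 0) = 0" "(0, 0) \<in> subdifferential j (0, 0)"
    and min: "\<And>v. energy T a \<Phi> F j u \<le> energy T a \<Phi> F j v"
    and u: "fdiff_norm T u \<le> a" "j (u 0, u (T + 1)) = ereal ju"
  shows "fdiff_norm T u < a"
proof (rule ccontr)
  assume "\<not> fdiff_norm T u < a"
  then obtain m where m: "m \<le> T" "norm (fdiff u m) = a"
    using u(1) unfolding fdiff_norm_le_iff fdiff_norm_less_iff by force
  have "0 \<le> j z" for z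
    using j(3,4) unfolding subdifferential_def by (cases z) (auto simp flip: zero_ereal_def)
  then have ju: "0 \<le> ju"
    using u(2) by (metis ereal_less_eq(5))
  have shrink: "\<Phi> ((1 - t) *\<^sub>R x) \<le> \<Phi> x" if x: "norm x \<le> a" and t: "0 < t" "t < 1" for x t
  proof -
    have "\<Phi> ((1 - t) *\<^sub>R x + t *\<^sub>R 0) \<le> (1 - t) * \<Phi> x + t * \<Phi> 0"
      using convex_onD[OF Phi_conv, of t x 0] x t a by simp
    moreover have "0 \<le> \<Phi> x"
      using convex_gradient_inequality[OF Phi_conv _ _ Phi_grad[of 0], of x] a x phi_0 Phi_0 by simp
    then have "0 \<le> t * \<Phi> x" using t by simp
    ultimately show ?thesis
      using Phi_0 by (simp add: algebra_simps)
  qed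
  define G where "G t = (\<Sum>n = 1..T. F n (u n + t *\<^sub>R (0 - u n)))" for t
  define D where "D = (\<Sum>n = 1..T. gradF n (u n) \<bullet> (0 - u n))"
  have G: "(G has_real_derivative D) (at 0)"
    unfolding G_def[abs_def] D_def
    by (intro DERIV_sum has_real_derivative_along_line F_grad) auto
  \<comment> \<open>The slope \<open>1 - D\<close> exceeds by 1 the largest one compatible with minimality, as the
    potential contributes \<open>- D\<close>.\<close>
  obtain b where b: "b > 0"
    "\<And>t. 0 < t \<Longrightarrow> t < b \<Longrightarrow> t * (1 - D) \<le> \<Phi> (fdiff u m) - \<Phi> ((1 - t) *\<^sub>R fdiff u m)"
    using boundary_slope_infinite[OF a homeo Phi_grad Phi_cont Phi_conv m(2), of "1 - D"]
    unfolding eventually_at_right_field by auto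
  have ineq: "- G 0 \<le> - t * (1 - D) - G t" if t: "0 < t" "t < min b 1" for t
  proof -
    have eq: "fdiff u k + t *\<^sub>R (fdiff (\<lambda>_. 0) k - fdiff u k) = (1 - t) *\<^sub>R fdiff u k" for k
      by (simp add: fdiff_def algebra_simps)
    have le: "norm ((1 - t) *\<^sub>R fdiff u k) \<le> a" if "k \<le> T" for k
    proof -
      have "norm ((1 - t) *\<^sub>R fdiff u k) \<le> norm (fdiff u k)"
        using t by (simp add: mult_left_le_one_le)
      then show ?thesis
        using u(1) that unfolding fdiff_norm_le_iff by fastforce
    qed
    have "finite_energy T \<Phi> F u
        \<le> t * (0 - ju) + finite_energy T \<Phi> F (\<lambda>k. u k + t *\<^sub>R (0 - u k))"
      using minimizer_segment_ineq[OF min u, of "\<lambda>_. 0" 0 t] j t le eq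
      by (simp add: zero_ereal_def)
    moreover have "t * (0 - ju) \<le> 0"
      using t ju by simp
    moreover have "(\<Sum>k\<le>T. \<Phi> (fdiff (\<lambda>k. u k + t *\<^sub>R (0 - u k)) k))
        \<le> (\<Sum>k\<le>T. \<Phi> (fdiff u k) - (if k = m then t * (1 - D) else 0))"
    proof (rule sum_mono)
      fix k assume "k \<in> {..T}"
      then have "norm (fdiff u k) \<le> a"
        using u(1) unfolding fdiff_norm_le_iff by simp
      then show "\<Phi> (fdiff (\<lambda>k. u k + t *\<^sub>R (0 - u k)) k)
          \<le> \<Phi> (fdiff u k) - (if k = m then t * (1 - D) else 0)"
        using shrink[of "fdiff u k" t] b(2)[of t] t
        unfolding fdiff_segment[of u t "\<lambda>_. 0"] eq by auto
    qed
    then have "(\<Sum>k\<le>T. \<Phi> (fdiff (\<lambda>k. u k + t *\<^sub>R (0 - u k)) k))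
        \<le> (\<Sum>k\<le>T. \<Phi> (fdiff u k)) - t * (1 - D)"
      using m(1) by (simp add: sum_subtractf sum.delta)
    ultimately show ?thesis
      unfolding finite_energy_def G_def by simp
  qed
  have "((\<lambda>t. - t * (1 - D) - G t) has_real_derivative (- (1 - D) - D)) (at 0)"
    by (auto intro!: derivative_eq_intros G)
  then have "0 \<le> - (1 - D) - D"
    by (rule derivative_nonneg_at_right_minimum[where e = "min b 1"]) (use b ineq in auto)
  then show False by simp
qed

text \<open>The competitor \<open>w\<close> need not satisfy the constraint on the steps: since the steps of \<open>u\<close> are
  interior, \<open>u + t (w - u)\<close> satisfies it for small \<open>t\<close>.\<close>
lemma minimizer_variational_ineq:
  fixes \<phi> :: "real ^ 'n \<Rightarrow> real ^ 'n"
  assumes Phi_grad: "\<And>x. x \<in> ball 0 a \<Longrightarrow> GDERIV \<Phi> x :> \<phi> x"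
    and F_grad: "\<And>n x. n \<in> {1..T} \<Longrightarrow> GDERIV (F n) x :> gradF n x"
    and j: "convex_fun j" "proper_fun j"
    and min: "\<And>v. energy T a \<Phi> F j u \<le> energy T a \<Phi> F j v"
    and u: "fdiff_norm T u < a" "j (u 0, u (T + 1)) = ereal ju"
    and w: "j (w 0, w (T + 1)) = ereal jw"
  shows "0 \<le> jw - ju + (\<Sum>k\<le>T. \<phi> (fdiff u k) \<bullet> (fdiff w k - fdiff u k))
    - (\<Sum>n = 1..T. gradF n (u n) \<bullet> (w n - u n))"
proof -
  define h where "h t = t * (jw - ju) + finite_energy T \<Phi> F (\<lambda>k. u k + t *\<^sub>R (w k - u k))" for t
  have "\<forall>\<^sub>F t in at_right 0. norm (fdiff u k + t *\<^sub>R (fdiff w k - fdiff u k)) < a" if "k \<le> T" for k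
  proof (rule order_tendstoD)
    show "((\<lambda>t. norm (fdiff u k + t *\<^sub>R (fdiff w k - fdiff u k))) \<longlongrightarrow>
        norm (fdiff u k + 0 *\<^sub>R (fdiff w k - fdiff u k))) (at_right 0)"
      by (intro tendsto_intros)
    show "norm (fdiff u k + 0 *\<^sub>R (fdiff w k - fdiff u k)) < a"
      using u(1) that unfolding fdiff_norm_less_iff by simp
  qed
  then have "\<forall>\<^sub>F t in at_right 0. \<forall>k\<in>{..T}. norm (fdiff u k + t *\<^sub>R (fdiff w k - fdiff u k)) < a"
    by (intro eventually_ball_finite) auto
  then obtain b where b: "b > 0"
    "\<And>t k. 0 < t \<Longrightarrow> t < b \<Longrightarrow> k \<le> T \<Longrightarrow> norm (fdiff u k + t *\<^sub>R (fdiff w k - fdiff u k)) < a"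
    unfolding eventually_at_right_field by auto
  have "h 0 \<le> h t" if "0 < t" "t < min b 1" for t
    using minimizer_segment_ineq[OF min less_imp_le[OF u(1)] u(2) w j, of t] b(2)[of t] that
    unfolding h_def by (simp add: less_imp_le)
  moreover have "(h has_real_derivative (jw - ju
      + ((\<Sum>k\<le>T. \<phi> (fdiff u k) \<bullet> (fdiff w k - fdiff u k))
        - (\<Sum>n = 1..T. gradF n (u n) \<bullet> (w n - u n))))) (at 0)"
    unfolding h_def[abs_def] finite_energy_def fdiff_segment
  proof (intro DERIV_add DERIV_diff DERIV_sum has_real_derivative_along_line)
    show "((\<lambda>t. t * (jw - ju)) has_real_derivative jw - ju) (at 0)"
      by (auto intro!: derivative_eq_intros)
    show "GDERIV \<Phi> (fdiff u k) :> \<phi> (fdiff u k)" if "k \<in> {..T}" for k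
      using u(1) that unfolding fdiff_norm_less_iff by (intro Phi_grad) simp
    show "GDERIV (F n) (u n) :> gradF n (u n)" if "n \<in> {1..T}" for n
      using F_grad that .
  qed
  ultimately have "0 \<le> jw - ju
      + ((\<Sum>k\<le>T. \<phi> (fdiff u k) \<bullet> (fdiff w k - fdiff u k))
        - (\<Sum>n = 1..T. gradF n (u n) \<bullet> (w n - u n)))"
    using derivative_nonneg_at_right_minimum[of h _ "min b 1"] b(1) by simp
  then show ?thesis
    by (simp only: add_diff_eq)
qed

text \<open>The hypothesis \<open>T \<ge> 1\<close> keeps the two boundary steps distinct, so that the end values can be
  varied independently.\<close>
lemma variational_ineq_imp_solution:
  fixes \<phi> :: "real ^ 'n \<Rightarrow> real ^ 'n"
  assumes T: "T \<ge> 1" and u: "u \<in> X_space T" "fdiff_norm T u < a" "j (u 0, u (T + 1)) = ereal ju"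
    and j: "proper_fun j"
    and ineq: "\<And>w jw. j (w 0, w (T + 1)) = ereal jw \<Longrightarrow>
      0 \<le> jw - ju + (\<Sum>k\<le>T. \<phi> (fdiff u k) \<bullet> (fdiff w k - fdiff u k))
        - (\<Sum>n = 1..T. gradF n (u n) \<bullet> (w n - u n))"
  shows "is_solution T a \<phi> gradF j u"
proof -
  have "- fdiff (\<lambda>k. \<phi> (fdiff u k)) (n - 1) = gradF n (u n)" if n: "n \<in> {1..T}" for n
  proof -
    define q where "q = \<phi> (fdiff u (n - 1)) - \<phi> (fdiff u n) - gradF n (u n)"
    have "0 \<le> q \<bullet> d" for d
    proof -
      \<comment> \<open>A change at \<open>n\<close> affects the two steps \<open>n - 1\<close> and \<open>n\<close>, and leaves the boundary
        values alone.\<close>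
      define w where "w = u(n := u n + d)"
      have "\<phi> (fdiff u k) \<bullet> (fdiff w k - fdiff u k)
          = (if k = n - 1 then \<phi> (fdiff u k) \<bullet> d else 0) - (if k = n then \<phi> (fdiff u k) \<bullet> d else 0)" for k
        using n unfolding w_def fdiff_def by (auto simp: inner_diff_right inner_add_right)
      then have "(\<Sum>k\<le>T. \<phi> (fdiff u k) \<bullet> (fdiff w k - fdiff u k))
          = \<phi> (fdiff u (n - 1)) \<bullet> d - \<phi> (fdiff u n) \<bullet> d"
        using n by (auto simp: sum_subtractf)
      moreover have "gradF i (u i) \<bullet> (w i - u i) = (if i = n then gradF i (u i) \<bullet> d else 0)" for i
        unfolding w_def by simp
      then have "(\<Sum>i = 1..T. gradF i (u i) \<bullet> (w i - u i)) = gradF n (u n) \<bullet> d"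
        using n by simp
      moreover have "j (w 0, w (T + 1)) = ereal ju"
        using n u(3) unfolding w_def by auto
      ultimately show ?thesis
        using ineq[of w ju] unfolding q_def by (simp add: inner_diff_left)
    qed
    from this[of "- q"] have "q = 0"
      by (simp add: inner_gt_zero_iff flip: not_less)
    then show ?thesis
      using n unfolding q_def by (simp add: fdiff_def[of "\<lambda>k. \<phi> (fdiff u k)"] algebra_simps)
  qed
  moreover have "(\<phi> (fdiff u 0), - \<phi> (fdiff u T)) \<in> subdifferential j (u 0, u (T + 1))"
  proof -
    have "j (u 0, u (T + 1)) + ereal ((\<phi> (fdiff u 0), - \<phi> (fdiff u T)) \<bullet> ((x, y) - (u 0, u (T + 1))))
      \<le> j (x, y)" for x y
    proof (cases "j (x, y)")
      case (real jw)
      define w where "w = u(0 := x, T + 1 := y)"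
      have "\<phi> (fdiff u k) \<bullet> (fdiff w k - fdiff u k)
          = (if k = T then \<phi> (fdiff u k) \<bullet> (y - u (T + 1)) else 0)
            - (if k = 0 then \<phi> (fdiff u k) \<bullet> (x - u 0) else 0)" if "k \<le> T" for k
        using T that unfolding w_def fdiff_def by (auto simp: inner_diff_right)
      then have "(\<Sum>k\<le>T. \<phi> (fdiff u k) \<bullet> (fdiff w k - fdiff u k))
          = (\<Sum>k\<le>T. (if k = T then \<phi> (fdiff u k) \<bullet> (y - u (T + 1)) else 0)
            - (if k = 0 then \<phi> (fdiff u k) \<bullet> (x - u 0) else 0))"
        by (intro sum.cong) auto
      also have "\<dots> = \<phi> (fdiff u T) \<bullet> (y - u (T + 1)) - \<phi> (fdiff u 0) \<bullet> (x - u 0)"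
        by (simp add: sum_subtractf)
      finally have "(\<Sum>k\<le>T. \<phi> (fdiff u k) \<bullet> (fdiff w k - fdiff u k))
        = \<phi> (fdiff u T) \<bullet> (y - u (T + 1)) - \<phi> (fdiff u 0) \<bullet> (x - u 0)" .
      moreover have "(\<Sum>n = 1..T. gradF n (u n) \<bullet> (w n - u n)) = 0"
        unfolding w_def by (intro sum.neutral) auto
      moreover have "j (w 0, w (T + 1)) = ereal jw"
        using real unfolding w_def by simp
      ultimately show ?thesis
        using ineq[of w jw] u(3) real by simp
    qed (use j in \<open>auto simp: proper_fun_def\<close>)
    then show ?thesis
      unfolding subdifferential_def by auto
  qed
  ultimately show ?thesis
    using u unfolding is_solution_def by blast
qed

section \<open>Attainment of the infimum by a solution\<close>

theorem theorem5p2: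
  fixes T :: nat and a \<delta> :: real
    and \<phi> :: "real ^ 'n \<Rightarrow> real ^ 'n"
    and \<Phi> :: "real ^ 'n \<Rightarrow> real"
    and F :: "nat \<Rightarrow> real ^ 'n \<Rightarrow> real"
    and gradF :: "nat \<Rightarrow> real ^ 'n \<Rightarrow> real ^ 'n"
    and j :: "(real ^ 'n) \<times> (real ^ 'n) \<Rightarrow> ereal"
  assumes T: "T \<ge> 2"
    and a: "a > 0"
    and phi_homeo: "\<exists>\<psi>. homeomorphism (ball 0 a) UNIV \<phi> \<psi>"
    and phi_0: "\<phi> 0 = 0"
    and Phi_grad: "\<And>x. x \<in> ball 0 a \<Longrightarrow> GDERIV \<Phi> x :> \<phi> x"
    and Phi_C1: "continuous_on (ball 0 a) \<phi>"
    and Phi_cont: "continuous_on (cball 0 a) \<Phi>"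
    and Phi_conv: "strictly_convex_on (cball 0 a) \<Phi>"
    and Phi_0: "\<Phi> 0 = 0"
    and F_cont: "continuous_on ({1..T} \<times> UNIV) (\<lambda>(n, x). F n x)"
    and F_grad: "\<And>n x. n \<in> {1..T} \<Longrightarrow> GDERIV (F n) x :> gradF n x"
    and F_C1: "continuous_on ({1..T} \<times> UNIV) (\<lambda>(n, x). gradF n x)"
    and F_0: "\<And>n. n \<in> {1..T} \<Longrightarrow> F n 0 = 0"
    and j_proper: "proper_fun j"
    and j_convex: "convex_fun j"
    and j_lsc: "lsc_fun j"
    and j_0: "j (0, 0) = 0"
    and j_sub: "(0, 0) \<in> subdifferential j (0, 0)"
    and delta: "\<delta> > 0"
    and inf_eq: "(INF v \<in> eff_dom_mean T a j \<delta>. energy T a \<Phi> F j v) =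
                 (INF v \<in> eff_dom T a j. energy T a \<Phi> F j v)"
  shows "(\<exists>m::real. \<forall>u \<in> X_space T. ereal m \<le> energy T a \<Phi> F j u) \<and>
    (\<exists>u \<in> eff_dom_mean T a j \<delta>.
       energy T a \<Phi> F j u = (INF v \<in> X_space T. energy T a \<Phi> F j v) \<and>
       is_solution T a \<phi> gradF j u)"
proof -
  obtain \<psi> where homeo: "homeomorphism (ball 0 a) UNIV \<phi> \<psi>"
    using phi_homeo by blast
  have "continuous_on UNIV (F n)" if "n \<in> {1..T}" for n
    using F_grad[OF that] unfolding gderiv_def
    by (intro continuous_at_imp_continuous_on) (auto intro: has_derivative_continuous)
  then obtain u where u: "u \<in> eff_dom_mean T a j \<delta>"
    and min_mean: "\<And>v. v \<in> eff_dom_mean T a j \<delta> \<Longrightarrow> energy T a \<Phi> F j u \<le> energy T a \<Phi> F j v"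
    using energy_attains_inf_on_eff_dom_mean[of a \<delta> \<Phi> T F j] a delta Phi_cont j_lsc j_0 by auto
  have X: "u \<in> X_space T" and le_a: "fdiff_norm T u \<le> a" and "j (u 0, u (T + 1)) < \<infinity>"
    using u unfolding eff_dom_mean_def eff_dom_def by auto
  moreover have "j (u 0, u (T + 1)) \<noteq> -\<infinity>"
    using j_proper unfolding proper_fun_def by blast
  ultimately obtain ju where ju: "j (u 0, u (T + 1)) = ereal ju"
    by (cases "j (u 0, u (T + 1))") auto
  have "energy T a \<Phi> F j u \<le> (INF v \<in> eff_dom T a j. energy T a \<Phi> F j v)"
    unfolding inf_eq[symmetric] by (intro INF_greatest min_mean)
  then have "energy T a \<Phi> F j u \<le> energy T a \<Phi> F j v" if "v \<in> eff_dom T a j" for v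
    using that by (meson INF_lower order_trans)
  then have min_X: "energy T a \<Phi> F j u \<le> energy T a \<Phi> F j v" if "v \<in> X_space T" for v
    using that energy_eq_top_outside_eff_dom[of v T a j \<Phi> F] j_proper by (cases "v \<in> eff_dom T a j") auto
  have min: "energy T a \<Phi> F j u \<le> energy T a \<Phi> F j v" for v
    using min_X[of "restrict v {0..T + 1}"] unfolding energy_restrict X_space_def by simp
  have less_a: "fdiff_norm T u < a"
    by (rule minimizer_steps_interior[OF a homeo phi_0 Phi_grad Phi_cont
          strictly_convex_on_imp_convex_on[OF Phi_conv] Phi_0 F_grad
          j_convex j_proper j_0 j_sub min le_a ju])
  have "is_solution T a \<phi> gradF j u"
  proof (rule variational_ineq_imp_solution[OF _ X less_a ju j_proper])
    show "1 \<le> T" using T by simp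
  qed (rule minimizer_variational_ineq[OF Phi_grad F_grad j_convex j_proper min less_a ju])
  moreover have "energy T a \<Phi> F j u = (INF v \<in> X_space T. energy T a \<Phi> F j v)"
    using X min by (intro antisym INF_greatest INF_lower)
  moreover have "ereal (ju + finite_energy T \<Phi> F u) \<le> energy T a \<Phi> F j v" for v
    using min[of v] energy_eq[OF le_a, of \<Phi> F j] ju by simp
  ultimately show ?thesis
    using u by blast
qed

end
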